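(* Let $d\in\mathbb{N}$, let $k\in\mathbb{Q}$ with $k\ge 2$, and let $P\subset\mathbb{R}^d$ be a rational polytope of dimension $d$ (not necessarily simple). If the lattice length of every edge of $P$ is at least $0.5\,d^2(d+1)k$, then $P$ is $k$-convex-normal, i.e. $$cP=\bigcup_{v\in\operatorname{vert}(P)}\ \bigcup_{x\in (c-1)P\cap\left((c-1)v+\mathbb{Z}^d\right)} (x+P)\qquad\text{for every } c\in\mathbb{Q}\text{ with }2\le c\le k.$$
   Context: A polytope is rational if all its vertices lie in $\mathbb{Q}^d$; $\operatorname{vert}(P)$ is its vertex set. The lattice length of a rational segment $[x,y]\subset\mathbb{R}^d$ is the ratio of its Euclidean length to the Euclidean length of the primitive integer vector (integer vector with coprime coordinates) in the direction of $y-x$. A rational $d$-polytope $P\subset\mathbb{R}^d$ is called $k$-convex-normal (for $k\in\mathbb{Q}_{\ge2}$) if the displayed equality holds for all rational $c\in[2,k]$. *)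

theory Defs
  imports "HOL-Analysis.Analysis"
begin

definition vert :: "'a::real_vector set \<Rightarrow> 'a set" where
  "vert P = {v. v extreme_point_of P}"

definition rational_polytope :: "(real^'n) set \<Rightarrow> bool" where
  "rational_polytope P \<longleftrightarrow> polytope P \<and> (\<forall>v\<in>vert P. \<forall>i. v $ i \<in> \<rat>)"

definition integer_lattice :: "(real^'n) set" where
  "integer_lattice = {z. \<forall>i. z $ i \<in> \<int>}"

definition primitive_vector :: "real^'n \<Rightarrow> bool" where
  "primitive_vector u \<longleftrightarrow>
     (\<exists>z :: int^'n. u = (\<chi> i. real_of_int (z $ i)) \<and> Gcd (range (\<lambda>i. z $ i)) = 1)"

text \<open>The description below determines a unique vector whenever \<open>x \<noteq> y\<close> and the line
  through \<open>x\<close> and \<open>y\<close> has a rational direction, in particular for every edge of a rational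
  polytope.\<close>

definition primitive_direction :: "real^'n \<Rightarrow> real^'n \<Rightarrow> real^'n" where
  "primitive_direction x y = (THE u. primitive_vector u \<and> (\<exists>t>0. y - x = t *\<^sub>R u))"

definition lattice_length :: "real^'n \<Rightarrow> real^'n \<Rightarrow> real" where
  "lattice_length x y = dist x y / norm (primitive_direction x y)"

definition convex_normal :: "real \<Rightarrow> (real^'n) set \<Rightarrow> bool" where
  "convex_normal k P \<longleftrightarrow>
     (\<forall>c\<in>\<rat>. 2 \<le> c \<and> c \<le> k \<longrightarrow>
        (\<lambda>p. c *\<^sub>R p) ` P =
          (\<Union>v\<in>vert P.
             \<Union>x\<in>(\<lambda>p. (c - 1) *\<^sub>R p) ` P \<inter> (\<lambda>z. (c - 1) *\<^sub>R v + z) ` integer_lattice.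
               (\<lambda>p. x + p) ` P))"

end

theory Submission imports Defs begin

text \<open>
  Let \<open>D\<close> be the ambient dimension. By induction on the dimension \<open>j\<close> of a face \<open>F\<close>, every
  \<open>q \<in> F\<close> admits a vertex \<open>v\<close> of \<open>F\<close> and \<open>x \<in> (c - 1) F \<inter> ((c - 1) v + \<int>\<^sup>D)\<close> with
  \<open>c q - x \<in> (j/D) F + (1 - j/D) q\<close>; for \<open>j = D\<close> this is the claim. By Helly's theorem \<open>F\<close> has a
  centre \<open>g\<close> with \<open>g + (F - F)/(D + 1) \<subseteq> F\<close>. Write \<open>q = (1 - t) p + t g\<close> with \<open>p\<close> on a facet of
  \<open>F\<close>. If \<open>t \<ge> 1/(Dk)\<close>, expand \<open>(c - 1)(q - v)\<close>, for any vertex \<open>v\<close>, in linearly independent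
  primitive edge vectors of \<open>F\<close> and round the coefficients to nearest integers: the error is a
  combination of at most \<open>j\<close> edge vectors with coefficients at most \<open>1/2\<close>, and since the edges are
  long it fits into the room around \<open>q\<close> inherited from \<open>g\<close>. If \<open>t < 1/(Dk)\<close>, the point \<open>x\<close>
  obtained for \<open>p\<close> from the facet also works for \<open>q\<close>: the displacement \<open>c t (g - p)\<close> is absorbed
  by the extra weight \<open>1/D\<close> on \<open>p\<close>.
\<close>

section \<open>Convex combinations and a centre of a polytope\<close>

text \<open>The filler point \<open>y\<close> takes up the missing weight: normalise the sum by its
  total weight, then combine with \<open>y\<close>. This avoids separate treatment of families that
  are too small.\<close>

lemma convex_sum_slack:
  fixes S :: "'a::real_vector set" and w :: "'i \<Rightarrow> real"
  assumes "convex S" "finite I" "\<And>i. i \<in> I \<Longrightarrow> 0 \<le> w i" "\<And>i. i \<in> I \<Longrightarrow> x i \<in> S"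
    and "sum w I \<le> 1" "y \<in> S"
  shows "(\<Sum>i\<in>I. w i *\<^sub>R x i) + (1 - sum w I) *\<^sub>R y \<in> S"
proof (cases "sum w I = 0")
  case True
  then have "w i = 0" if "i \<in> I" for i
    using assms that by (simp add: sum_nonneg_eq_0_iff)
  with True assms(6) show ?thesis by simp
next
  case False
  define r where "r = sum w I"
  have "r > 0"
    using False assms(3) sum_nonneg[of I w] by (simp add: r_def)
  have "(\<Sum>i\<in>I. (w i / r) *\<^sub>R x i) \<in> S"
    using assms \<open>r > 0\<close>
    by (intro convex_sum) (auto simp: r_def sum_divide_distrib[symmetric])
  then have "r *\<^sub>R (\<Sum>i\<in>I. (w i / r) *\<^sub>R x i) + (1 - r) *\<^sub>R y \<in> S"
    using assms \<open>r > 0\<close> by (intro convexD) (auto simp: r_def)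
  also have "r *\<^sub>R (\<Sum>i\<in>I. (w i / r) *\<^sub>R x i) = (\<Sum>i\<in>I. w i *\<^sub>R x i)"
    using \<open>r > 0\<close> by (simp add: scaleR_sum_right)
  finally show ?thesis
    by (simp add: r_def)
qed

text \<open>
  Helly's theorem applied to the sets of \<open>g\<close> that work for a fixed vertex \<open>b\<close>: for at most \<open>D + 1\<close>
  vertices, their (padded) average lies in all of these sets.
\<close>

lemma polytope_symmetric_center:
  fixes S :: "'a::euclidean_space set"
  assumes "polytope S" "S \<noteq> {}"
  obtains g where "g \<in> rel_interior S"
    and "\<And>a b. \<lbrakk>a \<in> S; b \<in> S\<rbrakk> \<Longrightarrow> g + (1 / (real DIM('a) + 1)) *\<^sub>R (a - b) \<in> S"
proof -
  define M where "M = real DIM('a) + 1"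
  have M: "M > 0" by (simp add: M_def)
  obtain V where V: "finite V" "S = convex hull V"
    using assms(1) polytope_def by blast
  have VS: "V \<subseteq> S" using V hull_subset by metis
  have cS: "convex S" using V by simp
  have "V \<noteq> {}" using V assms(2) by auto
  define K where "K b = {g. \<forall>a\<in>S. g + (1 / M) *\<^sub>R (a - b) \<in> S}" for b
  have convK: "convex (K b)" for b
  proof (rule convexI)
    fix x y :: 'a and u v :: real
    assume xy: "x \<in> K b" "y \<in> K b" and uv: "0 \<le> u" "0 \<le> v" "u + v = 1"
    show "u *\<^sub>R x + v *\<^sub>R y \<in> K b"
      unfolding K_def
    proof safe
      fix a assume "a \<in> S"
      with xy have "u *\<^sub>R (x + (1 / M) *\<^sub>R (a - b)) + v *\<^sub>R (y + (1 / M) *\<^sub>R (a - b)) \<in> S"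
        using uv cS by (intro convexD) (auto simp: K_def)
      also have "u *\<^sub>R (x + (1 / M) *\<^sub>R (a - b)) + v *\<^sub>R (y + (1 / M) *\<^sub>R (a - b))
          = u *\<^sub>R x + v *\<^sub>R y + (u + v) *\<^sub>R ((1 / M) *\<^sub>R (a - b))"
        by (simp only: scaleR_add_right scaleR_add_left) simp
      finally show "u *\<^sub>R x + v *\<^sub>R y + (1 / M) *\<^sub>R (a - b) \<in> S"
        using uv by simp
    qed
  qed
  have small: "\<Inter>(K ` B) \<noteq> {}" if B: "B \<subseteq> V" "card B \<le> DIM('a) + 1" for B
  proof -
    have fB: "finite B" using B V finite_subset by blast
    obtain b0 where b0: "b0 \<in> V" using \<open>V \<noteq> {}\<close> by blast
    define r where "r = M - real (card B)"
    have r: "r \<ge> 0" using B by (simp add: r_def M_def)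
    have "(1 / M) *\<^sub>R (\<Sum>B + r *\<^sub>R b0) \<in> K b" if b: "b \<in> B" for b
      unfolding K_def
    proof safe
      fix a assume a: "a \<in> S"
      \<comment> \<open>Adding \<open>(1 / M) *\<^sub>R (a - b)\<close> exchanges \<open>b\<close>
        for \<open>a\<close> in the padded average. The point \<open>y\<close> merges this
        \<open>a\<close> with the padding \<open>b0\<close>, so that all weight outside
        \<open>B - {b}\<close> sits on one filler point.\<close>
      define y where "y = (1 / (1 + r)) *\<^sub>R a + (r / (1 + r)) *\<^sub>R b0"
      have "y \<in> S"
        unfolding y_def using a b0 VS cS r
        by (intro convexD) (auto simp: add_divide_distrib[symmetric])
      have card: "real (card (B - {b})) = real (card B) - 1"
        using b fB by (metis One_nat_def card_Diff_singleton card_gt_0_iff empty_iff of_nat_1 of_nat_diff Suc_leI)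
      have "(\<Sum>x\<in>B - {b}. (1 / M) *\<^sub>R x) + (1 - (\<Sum>x\<in>B - {b}. 1 / M)) *\<^sub>R y \<in> S"
        using cS fB B VS \<open>y \<in> S\<close> M card r
        by (intro convex_sum_slack) (auto simp: r_def)
      also have "(\<Sum>x\<in>B - {b}. (1 / M) *\<^sub>R x) + (1 - (\<Sum>x\<in>B - {b}. 1 / M)) *\<^sub>R y
          = (1 / M) *\<^sub>R (\<Sum>(B - {b}) + (M - real (card (B - {b}))) *\<^sub>R y)"
        using M by (simp add: scaleR_sum_right[symmetric] scaleR_add_right diff_divide_distrib)
      also have "(M - real (card (B - {b}))) *\<^sub>R y = a + r *\<^sub>R b0"
      proof -
        have "M - real (card (B - {b})) = 1 + r" using card by (simp add: r_def)
        then show ?thesis using r by (simp add: y_def scaleR_add_right)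
      qed
      also have "(1 / M) *\<^sub>R (\<Sum>(B - {b}) + (a + r *\<^sub>R b0))
          = (1 / M) *\<^sub>R (\<Sum>B + r *\<^sub>R b0) + (1 / M) *\<^sub>R (a - b)"
        using b fB by (simp add: sum.remove[of B b] algebra_simps)
      finally show "(1 / M) *\<^sub>R (\<Sum>B + r *\<^sub>R b0) + (1 / M) *\<^sub>R (a - b) \<in> S" .
    qed
    then show ?thesis by blast
  qed
  have pick: "\<Inter>t \<noteq> {}" if t: "t \<subseteq> K ` V" "card t \<le> DIM('a) + 1" for t
  proof -
    \<comment> \<open>Distinct vertices may give the same set, so one vertex per member of
      \<open>t\<close> is selected; then \<open>B\<close> and \<open>t\<close> have equal
      cardinality.\<close>
    obtain B where "B \<subseteq> V" "inj_on K B" "t = K ` B"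
      using t(1) by (meson subset_image_inj)
    then show ?thesis
      using small t(2) by (simp add: card_image)
  qed
  \<comment> \<open>Helly's theorem is applied when there are at least \<open>DIM('a) + 1\<close>
    sets; a smaller family is itself an instance of \<open>pick\<close>.\<close>
  have "\<Inter>(K ` V) \<noteq> {}"
  proof (cases "card (K ` V) \<ge> DIM('a) + 1")
    case True
    show ?thesis
      by (rule Helly[OF True]) (use convK pick in auto)
  next
    case False
    then show ?thesis by (intro pick) auto
  qed
  then obtain g where g: "\<And>b. b \<in> V \<Longrightarrow> g \<in> K b" by blast
  \<comment> \<open>For fixed \<open>a\<close>, the admissible \<open>b\<close> form the preimage of
    \<open>S\<close> under an affine map. It is convex, so containing \<open>V\<close> it contains
    the hull.\<close>
  have gS: "g + (1 / M) *\<^sub>R (a - b) \<in> S" if "a \<in> S" "b \<in> S" for a b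
  proof -
    have "convex ((\<lambda>b. g + (1 / M) *\<^sub>R (a - b)) -` S)"
    proof (rule convexI)
      fix x y :: 'a and u v :: real
      assume xy: "x \<in> (\<lambda>b. g + (1 / M) *\<^sub>R (a - b)) -` S" "y \<in> (\<lambda>b. g + (1 / M) *\<^sub>R (a - b)) -` S"
        and uv: "0 \<le> u" "0 \<le> v" "u + v = 1"
      then have "u *\<^sub>R (g + (1 / M) *\<^sub>R (a - x)) + v *\<^sub>R (g + (1 / M) *\<^sub>R (a - y)) \<in> S"
        using cS by (intro convexD) auto
      also have "u *\<^sub>R (g + (1 / M) *\<^sub>R (a - x)) + v *\<^sub>R (g + (1 / M) *\<^sub>R (a - y))
          = (u + v) *\<^sub>R g + (1 / M) *\<^sub>R ((u + v) *\<^sub>R a - (u *\<^sub>R x + v *\<^sub>R y))"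
        by (simp add: algebra_simps)
      finally show "u *\<^sub>R x + v *\<^sub>R y \<in> (\<lambda>b. g + (1 / M) *\<^sub>R (a - b)) -` S"
        using uv by simp
    qed
    moreover have "V \<subseteq> (\<lambda>b. g + (1 / M) *\<^sub>R (a - b)) -` S"
      using g that(1) by (auto simp: K_def)
    ultimately have "convex hull V \<subseteq> (\<lambda>b. g + (1 / M) *\<^sub>R (a - b)) -` S"
      by (rule hull_minimal[rotated])
    with that V show ?thesis by blast
  qed
  have "g \<in> S"
    using gS[of "SOME x. x \<in> S" "SOME x. x \<in> S"] assms(2) by (simp add: some_in_eq)
  have "g \<in> rel_interior S"
    unfolding convex_rel_interior_iff[OF cS assms(2)]
  proof
    fix x assume "x \<in> S"
    \<comment> \<open>The segment from \<open>x\<close> to \<open>g\<close> extends beyond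
      \<open>g\<close>: this is the centre property for the difference \<open>g - x\<close>.\<close>
    have "(1 - (1 + 1 / M)) *\<^sub>R x + (1 + 1 / M) *\<^sub>R g \<in> S"
      using gS[OF \<open>g \<in> S\<close> \<open>x \<in> S\<close>] by (simp add: algebra_simps)
    then show "\<exists>e>1. (1 - e) *\<^sub>R x + e *\<^sub>R g \<in> S"
      using M by (intro exI[of _ "1 + 1 / M"]) auto
  qed
  then show ?thesis using that[of g] gS unfolding M_def by blast
qed

section \<open>Edge vectors span the directions of a polytope\<close>

lemma polytope_aff_dim_1_segment:
  fixes S :: "'a::euclidean_space set"
  assumes "polytope S" "aff_dim S = 1"
  obtains a b where "S = closed_segment a b"
proof (rule compact_convex_collinear_segment[of S])
  show "S \<noteq> {}" using assms(2) by auto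
  show "compact S" using assms(1) by (rule polytope_imp_compact)
  show "convex S" using assms(1) by (rule polytope_imp_convex)
  show "collinear S" using assms(2) by (simp add: collinear_aff_dim)
qed (use that in blast)

text \<open>
  Inductively the functional is constant on each facet, so it takes finitely many values on the
  relative frontier, which is connected in dimension at least two.
\<close>

lemma inner_constant_on_polytope:
  fixes S :: "'a::euclidean_space set"
  assumes "polytope S"
    and "\<And>x y. closed_segment x y edge_of S \<Longrightarrow> w \<bullet> x = w \<bullet> y"
    and "a \<in> S" "b \<in> S"
  shows "w \<bullet> a = w \<bullet> b"
  using assms
proof (induction "nat (aff_dim S)" arbitrary: S a b rule: less_induct)
  case less
  have "aff_dim S \<ge> 0"
    using less.prems(3) by (metis aff_dim_negative_iff empty_iff not_le)
  then consider "aff_dim S = 0" | "aff_dim S = 1" | "aff_dim S \<ge> 2" by linarith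
  then show ?case
  proof cases
    case 1
    then show ?thesis using less.prems(3,4) by (auto simp: aff_dim_eq_0)
  next
    case 2
    then obtain x y where xy: "S = closed_segment x y"
      using polytope_aff_dim_1_segment less.prems(1) by blast
    then have "S edge_of S"
      using 2 by (simp add: edge_of_def face_of_refl)
    then have eq: "w \<bullet> x = w \<bullet> y" using less.prems(2) xy by blast
    have "w \<bullet> p = w \<bullet> x" if p: "p \<in> S" for p
    proof -
      obtain u where "p = (1 - u) *\<^sub>R x + u *\<^sub>R y"
        using p unfolding xy in_segment by blast
      then show ?thesis using eq by (simp add: inner_add_right left_diff_distrib)
    qed
    then show ?thesis using less.prems by metis
  next
    case 3
    have poly: "polyhedron S" using less.prems(1) polytope_imp_polyhedron by blast
    have facet_const: "w \<bullet> p = w \<bullet> q" if "F facet_of S" "p \<in> F" "q \<in> F" for F p q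
    proof (rule less.hyps[of F])
      have F: "F face_of S" "aff_dim F = aff_dim S - 1"
        using that by (auto simp: facet_of_def)
      show "nat (aff_dim F) < nat (aff_dim S)" using F 3 by simp
      show "polytope F" using F less.prems(1) face_of_polytope_polytope by blast
      show "w \<bullet> x = w \<bullet> y" if "closed_segment x y edge_of F" for x y
        using that F less.prems(2) by (meson edge_of_def face_of_trans)
    qed (use that in auto)
    have "(\<lambda>x. w \<bullet> x) ` rel_frontier S \<subseteq> (\<lambda>F. w \<bullet> (SOME p. p \<in> F)) ` {F. F facet_of S}"
    proof safe
      fix p assume "p \<in> rel_frontier S"
      then obtain F where F: "F facet_of S" "p \<in> F"
        using rel_frontier_of_polyhedron[OF poly] by blast
      then have "w \<bullet> p = w \<bullet> (SOME p. p \<in> F)"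
        using facet_const by (metis someI)
      with F show "w \<bullet> p \<in> (\<lambda>F. w \<bullet> (SOME p. p \<in> F)) ` {F. F facet_of S}" by blast
    qed
    then have "finite ((\<lambda>x. w \<bullet> x) ` rel_frontier S)"
      using finite_polytope_facets[OF less.prems(1)] finite_surj by blast
    moreover have "connected (rel_frontier S)"
      using 3 less.prems(1)
      by (intro connected_sphere_gen) (auto simp: polytope_imp_convex polytope_imp_bounded)
    ultimately have "(\<lambda>x. w \<bullet> x) constant_on rel_frontier S"
      by (intro continuous_finite_range_constant) (auto intro: continuous_intros)
    then obtain c where c: "\<And>x. x \<in> rel_frontier S \<Longrightarrow> w \<bullet> x = c"
      unfolding constant_on_def by blast
    \<comment> \<open>Vertices are proper faces and so lie on the relative frontier; as
      \<open>S\<close> is their hull, the constant value spreads from there to all of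
      \<open>S\<close>.\<close>
    have "{x. x extreme_point_of S} \<subseteq> {x. w \<bullet> x = c}"
    proof safe
      fix v assume v: "v extreme_point_of S"
      then have "{v} face_of S" by (simp add: face_of_singleton)
      moreover have "{v} \<noteq> S" using 3 by auto
      ultimately have "v \<in> rel_frontier S"
        using rel_frontier_of_polyhedron_alt[OF poly] by blast
      then show "w \<bullet> v = c" by (rule c)
    qed
    then have "convex hull {x. x extreme_point_of S} \<subseteq> {x. w \<bullet> x = c}"
      by (intro hull_minimal convex_hyperplane)
    then have "S \<subseteq> {x. w \<bullet> x = c}"
      using Krein_Milman_Minkowski less.prems(1) polytope_imp_compact polytope_imp_convex by metis
    then show ?thesis using less.prems(3,4) by auto
  qed
qed

text \<open>The component \<open>z\<close> of \<open>a - b\<close> orthogonal to all edges defines a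
  functional constant along edges, hence constant on \<open>S\<close>. So \<open>z\<close> is
  orthogonal to \<open>a - b\<close> and therefore to itself.\<close>

lemma polytope_diff_in_span_edges:
  fixes S :: "'a::euclidean_space set"
  assumes "polytope S" "a \<in> S" "b \<in> S"
  shows "a - b \<in> span {y - x | x y. closed_segment x y edge_of S}"
proof -
  let ?E = "{y - x | x y. closed_segment x y edge_of S}"
  obtain y z where yz: "y \<in> span ?E" "\<And>w. w \<in> span ?E \<Longrightarrow> orthogonal z w" "a - b = y + z"
    using orthogonal_subspace_decomp_exists[of ?E "a - b"] by blast
  have "z \<bullet> a = z \<bullet> b"
  proof (rule inner_constant_on_polytope[OF assms(1) _ assms(2,3)])
    fix x y assume "closed_segment x y edge_of S"
    then have "y - x \<in> span ?E" by (intro span_base) blast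
    then have "z \<bullet> (y - x) = 0" using yz(2) by (simp add: orthogonal_def)
    then show "z \<bullet> x = z \<bullet> y" by (simp add: inner_diff_right)
  qed
  then have "z \<bullet> (y + z) = 0" using yz(3) by (metis inner_diff_right right_minus_eq)
  moreover have "z \<bullet> y = 0" using yz(1,2) by (simp add: orthogonal_def)
  ultimately have "z = 0" by (simp add: inner_add_right)
  with yz show ?thesis by simp
qed

text \<open>A basis chosen among the edge vectors. Its size is bounded by the dimension because edge
  vectors are themselves differences of points of \<open>S\<close>; this later bounds the number of
  rounding errors.\<close>

lemma polytope_edge_basis:
  fixes S :: "'a::euclidean_space set"
  assumes "polytope S" "S \<noteq> {}"
  obtains B where "finite B" "int (card B) \<le> aff_dim S"
    and "\<And>e. e \<in> B \<Longrightarrow> \<exists>x y. e = y - x \<and> closed_segment x y edge_of S"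
    and "\<And>a b. \<lbrakk>a \<in> S; b \<in> S\<rbrakk> \<Longrightarrow> a - b \<in> span B"
proof -
  define E where "E = {y - x | x y. closed_segment x y edge_of S}"
  obtain B where B: "B \<subseteq> E" "independent B" "E \<subseteq> span B"
    by (rule basis_exists[of E])
  obtain p where p: "p \<in> S" using assms(2) by blast
  have "E \<subseteq> span ((\<lambda>x. x - p) ` S)"
    unfolding E_def
  proof safe
    fix x y assume e: "closed_segment x y edge_of S"
    then have "x \<in> S" "y \<in> S" using edge_of_imp_subset by blast+
    then have "(y - p) - (x - p) \<in> span ((\<lambda>x. x - p) ` S)"
      by (intro span_diff span_base) auto
    then show "y - x \<in> span ((\<lambda>x. x - p) ` S)" by simp
  qed
  with B(1) have "B \<subseteq> span ((\<lambda>x. x - p) ` S)" by (rule order_trans)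
  then have "card B \<le> dim ((\<lambda>x. x - p) ` S)"
    using independent_card_le_dim[OF _ B(2)] dim_span by metis
  then have "int (card B) \<le> aff_dim S"
    using aff_dim_eq_dim_subtract[of p S] p by (simp add: hull_inc)
  moreover have "a - b \<in> span B" if "a \<in> S" "b \<in> S" for a b
  proof -
    have "a - b \<in> span E"
      using polytope_diff_in_span_edges[OF assms(1) that] by (simp add: E_def)
    also have "span E \<subseteq> span B" using B(3) by (simp add: span_minimal)
    finally show ?thesis .
  qed
  moreover have "\<exists>x y. e = y - x \<and> closed_segment x y edge_of S" if "e \<in> B" for e
    using B(1) that unfolding E_def by blast
  ultimately show ?thesis
    using that[of B] independent_imp_finite[OF B(2)] by blast
qed

section \<open>Primitive directions and lattice length\<close>

text \<open>Clearing denominators by \<open>N\<close> turns \<open>y - x\<close> into the integer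
  vector \<open>a\<close>. Dividing by its gcd \<open>G\<close>, nonzero since
  \<open>x \<noteq> y\<close>, leaves a primitive vector with factor \<open>G / N\<close>.\<close>

lemma primitive_direction_exists:
  fixes x y :: "real^'n"
  assumes "x \<noteq> y" "\<And>i. x $ i \<in> \<rat>" "\<And>i. y $ i \<in> \<rat>"
  shows "\<exists>u. primitive_vector u \<and> (\<exists>t>0. y - x = t *\<^sub>R u)"
proof -
  have "\<forall>i. \<exists>m::int. \<exists>n::nat. n \<noteq> 0 \<and> (y - x) $ i = real_of_int m / real n"
  proof
    fix i
    have "(y - x) $ i \<in> \<rat>" using assms by simp
    then obtain m::int and n::int where "n > 0" "(y - x) $ i = of_int m / of_int n"
      by (elim Rats_cases') blast
    then show "\<exists>m::int. \<exists>n::nat. n \<noteq> 0 \<and> (y - x) $ i = real_of_int m / real n"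
      by (intro exI[of _ m] exI[of _ "nat n"]) auto
  qed
  then obtain m n where mn: "\<And>i. n i \<noteq> (0::nat)" "\<And>i. (y - x) $ i = real_of_int (m i) / real (n i)"
    by metis
  define N where "N = (\<Prod>i\<in>UNIV. n i)"
  have N: "N > 0" using mn by (simp add: N_def prod_pos)
  define a where "a i = m i * int (\<Prod>j\<in>UNIV - {i}. n j)" for i
  have a: "real N * (y - x) $ i = real_of_int (a i)" for i
  proof -
    have "N = n i * (\<Prod>j\<in>UNIV - {i}. n j)" by (simp add: N_def prod.remove)
    then show ?thesis using mn(1)[of i] mn(2)[of i] by (simp add: a_def)
  qed
  define G where "G = Gcd (range a)"
  obtain i where i: "x $ i \<noteq> y $ i" using assms(1) by (auto simp: vec_eq_iff)
  then have "a i \<noteq> 0" using a[of i] N by auto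
  then have "G \<noteq> 0" by (auto simp: G_def)
  moreover have "G \<ge> 0" by (simp add: G_def)
  ultimately have G: "G > 0" by simp
  define z where "z = (\<chi> i. a i div G)"
  have az: "a i = G * z $ i" for i by (simp add: z_def G_def)
  have "G = Gcd ((\<lambda>i. G * z $ i) ` UNIV)"
    unfolding G_def[symmetric] using az by (metis (no_types, lifting) G_def image_cong)
  also have "\<dots> = G * Gcd (range (\<lambda>i. z $ i))"
    using G Gcd_mult[of G "range (\<lambda>i. z $ i)"] by (simp add: image_image)
  finally have "Gcd (range (\<lambda>i. z $ i)) = 1" using G by simp
  then have "primitive_vector (\<chi> i. real_of_int (z $ i))"
    unfolding primitive_vector_def by blast
  moreover have "y - x = (real_of_int G / real N) *\<^sub>R (\<chi> i. real_of_int (z $ i))"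
    unfolding vec_eq_iff
  proof
    fix i
    show "(y - x) $ i = ((real_of_int G / real N) *\<^sub>R (\<chi> i. real_of_int (z $ i))) $ i"
      using a[of i] az[of i] N by (simp add: field_simps)
  qed
  moreover have "real_of_int G / real N > 0" using G N by simp
  ultimately show ?thesis by blast
qed

text \<open>The real factors are traded for integers: with \<open>m\<close> and \<open>m'\<close>
  the absolute values of one coordinate, nonzero in \<open>z\<close>, proportionality gives
  \<open>m' * z $ j = m * z' $ j\<close> for all \<open>j\<close>. Taking gcds forces
  \<open>m' = m\<close>, hence \<open>t = t'\<close>.\<close>

lemma primitive_vector_parallel_unique:
  fixes u u' :: "real^'n"
  assumes "primitive_vector u" "primitive_vector u'" "t > 0" "t' > 0" "t *\<^sub>R u = t' *\<^sub>R u'"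
  shows "u = u'"
proof -
  obtain z z' :: "int^'n" where z: "u = (\<chi> i. real_of_int (z $ i))" "Gcd (range (\<lambda>i. z $ i)) = 1"
    and z': "u' = (\<chi> i. real_of_int (z' $ i))" "Gcd (range (\<lambda>i. z' $ i)) = 1"
    using assms(1,2) unfolding primitive_vector_def by blast
  have comp: "t * real_of_int (z $ i) = t' * real_of_int (z' $ i)" for i
    using assms(5) z z' by (simp add: vec_eq_iff)
  obtain i where i: "z $ i \<noteq> 0"
  proof (rule ccontr)
    assume "\<not> thesis"
    then have "\<And>i. z $ i = 0" using that by blast
    then show False using z(2) by simp
  qed
  define m where "m = \<bar>z $ i\<bar>"
  define m' where "m' = \<bar>z' $ i\<bar>"
  have tm: "t * real_of_int m = t' * real_of_int m'"
    using comp[of i] assms(3,4) unfolding m_def m'_def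
    by (metis abs_mult abs_of_pos of_int_abs)
  have "m > 0" using i by (simp add: m_def)
  have "m' * z $ j = m * z' $ j" for j
  proof -
    have "t * t' * real_of_int (m' * z $ j) = (t' * real_of_int m') * (t * real_of_int (z $ j))"
      by simp
    also have "\<dots> = (t * real_of_int m) * (t' * real_of_int (z' $ j))"
      using tm comp by simp
    also have "\<dots> = t * t' * real_of_int (m * z' $ j)" by simp
    finally show ?thesis using assms(3,4) by (metis mult_cancel_left mult_pos_pos not_less_iff_gr_or_eq of_int_eq_iff)
  qed
  then have "Gcd ((*) m' ` range (\<lambda>i. z $ i)) = Gcd ((*) m ` range (\<lambda>i. z' $ i))"
    by (simp add: image_image)
  then have "\<bar>m'\<bar> = \<bar>m\<bar>" by (simp add: Gcd_mult z z')
  then have "m' = m" by (simp add: m_def m'_def)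
  then have "t = t'" using tm \<open>m > 0\<close> by simp
  then show ?thesis using assms by simp
qed

text \<open>Existence and uniqueness evaluate the definite description, so the lattice length
  becomes the factor of an integer vector.\<close>

lemma lattice_length_eq:
  fixes x y :: "real^'n"
  assumes "x \<noteq> y" "\<And>i. x $ i \<in> \<rat>" "\<And>i. y $ i \<in> \<rat>"
  obtains u where "u \<in> integer_lattice" "y - x = lattice_length x y *\<^sub>R u"
proof -
  obtain u t where u: "primitive_vector u" "t > 0" "y - x = t *\<^sub>R u"
    using primitive_direction_exists[OF assms] by blast
  have "primitive_direction x y = u"
    unfolding primitive_direction_def
  proof (rule the_equality)
    fix u' assume "primitive_vector u' \<and> (\<exists>t>0. y - x = t *\<^sub>R u')"
    then show "u' = u" using u primitive_vector_parallel_unique by metis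
  qed (use u in blast)
  moreover have "u \<noteq> 0" using u assms(1) by auto
  moreover have "dist x y = t * norm u"
    using u by (metis abs_of_pos dist_commute dist_norm norm_scaleR)
  ultimately have "lattice_length x y = t"
    by (simp add: lattice_length_def)
  moreover have "u \<in> integer_lattice"
    using u(1) by (auto simp: primitive_vector_def integer_lattice_def)
  ultimately show ?thesis using u that by blast
qed


section \<open>Decomposition of dilated points\<close>

text \<open>Each \<open>r e *\<^sub>R e\<close> is a nonnegative multiple of a difference
  \<open>a e - b e\<close>. Averaging the \<open>a e\<close> and the \<open>b e\<close> with weights
  \<open>M * \<bar>r e\<bar>\<close>, both padded by \<open>g\<close>, turns the whole sum into a
  single difference of points of \<open>S\<close>.\<close>

lemma symmetric_center_room:
  fixes S :: "'a::euclidean_space set" and M :: real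
  assumes "convex S" "M > 0" "g \<in> S"
    and center: "\<And>a b. \<lbrakk>a \<in> S; b \<in> S\<rbrakk> \<Longrightarrow> g + (1 / M) *\<^sub>R (a - b) \<in> S"
    and "finite B" and B: "\<And>e. e \<in> B \<Longrightarrow> \<exists>x\<in>S. \<exists>y\<in>S. e = y - x"
    and "(\<Sum>e\<in>B. \<bar>r e\<bar>) \<le> 1 / M"
  shows "g + (\<Sum>e\<in>B. r e *\<^sub>R e) \<in> S"
proof -
  have "\<exists>a\<in>S. \<exists>b\<in>S. r e *\<^sub>R e = \<bar>r e\<bar> *\<^sub>R (a - b)" if e: "e \<in> B" for e
  proof -
    obtain x y where xy: "x \<in> S" "y \<in> S" "e = y - x" using B[OF e] by blast
    show ?thesis
    proof (cases "r e \<ge> 0")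
      case True
      with xy show ?thesis by (intro bexI[of _ y] bexI[of _ x]) auto
    next
      case False
      with xy show ?thesis by (intro bexI[of _ x] bexI[of _ y]) (auto simp: algebra_simps)
    qed
  qed
  then obtain a b where ab: "\<And>e. e \<in> B \<Longrightarrow> a e \<in> S" "\<And>e. e \<in> B \<Longrightarrow> b e \<in> S"
    "\<And>e. e \<in> B \<Longrightarrow> r e *\<^sub>R e = \<bar>r e\<bar> *\<^sub>R (a e - b e)"
    by metis
  define w where "w e = M * \<bar>r e\<bar>" for e
  have w: "sum w B \<le> 1"
    using assms(2,7) by (simp add: w_def sum_distrib_left[symmetric] field_simps)
  have slack: "(\<Sum>e\<in>B. w e *\<^sub>R x e) + (1 - sum w B) *\<^sub>R g \<in> S" if "\<And>e. e \<in> B \<Longrightarrow> x e \<in> S" for x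
    using assms(1,2,3,5) w that by (intro convex_sum_slack) (auto simp: w_def)
  have "g + (1 / M) *\<^sub>R (((\<Sum>e\<in>B. w e *\<^sub>R a e) + (1 - sum w B) *\<^sub>R g)
      - ((\<Sum>e\<in>B. w e *\<^sub>R b e) + (1 - sum w B) *\<^sub>R g)) \<in> S"
    by (intro center slack ab)
  also have "((\<Sum>e\<in>B. w e *\<^sub>R a e) + (1 - sum w B) *\<^sub>R g)
      - ((\<Sum>e\<in>B. w e *\<^sub>R b e) + (1 - sum w B) *\<^sub>R g) = (\<Sum>e\<in>B. w e *\<^sub>R (a e - b e))"
    by (simp add: scaleR_diff_right sum_subtractf)
  also have "(1 / M) *\<^sub>R \<dots> = (\<Sum>e\<in>B. r e *\<^sub>R e)"
    unfolding scaleR_sum_right using ab(3) assms(2) by (intro sum.cong) (auto simp: w_def)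
  finally show ?thesis .
qed

lemma integer_lattice_sum_scaleR:
  assumes "finite B" "\<And>e. e \<in> B \<Longrightarrow> u e \<in> integer_lattice" "\<And>e. e \<in> B \<Longrightarrow> m e \<in> \<int>"
  shows "(\<Sum>e\<in>B. m e *\<^sub>R u e) \<in> integer_lattice"
  using assms unfolding integer_lattice_def by (auto intro!: Ints_sum Ints_mult)

text \<open>The rounding case. The edge hypothesis is stated with integer vectors and factors so
  that it passes directly to faces. Here \<open>(c - 1) *\<^sub>R y\<close> is the summand called
  \<open>x\<close> in the overview.\<close>

lemma near_center_decomposition:
  fixes S :: "(real^'n) set" and c k t :: real
  defines "D \<equiv> real CARD('n)"
  defines "\<phi> \<equiv> real_of_int (aff_dim S) / D"
  assumes S: "polytope S" "aff_dim S \<ge> 1" and c: "2 \<le> c" "c \<le> k"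
    and edges: "\<And>x y. closed_segment x y edge_of S \<Longrightarrow>
      \<exists>u\<in>integer_lattice. \<exists>l. 1 / 2 * D ^ 2 * (D + 1) * k \<le> l \<and> y - x = l *\<^sub>R u"
    and g: "g \<in> S" "\<And>a b. \<lbrakk>a \<in> S; b \<in> S\<rbrakk> \<Longrightarrow> g + (1 / (D + 1)) *\<^sub>R (a - b) \<in> S"
    and p: "p \<in> S" and q: "q = (1 - t) *\<^sub>R p + t *\<^sub>R g" and t: "1 / (D * k) \<le> t" "t \<le> 1"
    and v: "v \<in> S"
  shows "\<exists>z\<in>integer_lattice. \<exists>y\<in>S. \<exists>f\<in>S. (c - 1) *\<^sub>R v + z = (c - 1) *\<^sub>R y \<and>
    c *\<^sub>R q - (c - 1) *\<^sub>R y = \<phi> *\<^sub>R f + (1 - \<phi>) *\<^sub>R q"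
proof -
  have cS: "convex S" using S(1) by (rule polytope_imp_convex)
  have D: "D \<ge> 1" unfolding D_def by (simp add: Suc_leI)
  have k: "k \<ge> 2" using c by simp
  have tpos: "t > 0" using t(1) D k by (smt (verit) divide_pos_pos mult_pos_pos)
  have "aff_dim S \<le> int CARD('n)" using aff_dim_le_DIM[of S] by simp
  then have \<phi>: "0 < \<phi>" "\<phi> \<le> 1" using S(2) D by (auto simp: \<phi>_def D_def)
  have qS: "q \<in> S" unfolding q using cS p g t tpos by (intro convexD) auto
  obtain B where B: "finite B" "int (card B) \<le> aff_dim S"
    "\<And>e. e \<in> B \<Longrightarrow> \<exists>x y. e = y - x \<and> closed_segment x y edge_of S"
    "\<And>a b. \<lbrakk>a \<in> S; b \<in> S\<rbrakk> \<Longrightarrow> a - b \<in> span B"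
    using polytope_edge_basis[OF S(1)] v by blast
  define L where "L = 1 / 2 * D ^ 2 * (D + 1) * k"
  have L: "L > 0" using D k by (simp add: L_def)
  have "\<exists>u l. u \<in> integer_lattice \<and> L \<le> l \<and> e = l *\<^sub>R u" if "e \<in> B" for e
    using B(3)[OF that] edges unfolding L_def by metis
  then obtain u l where ul: "\<And>e. e \<in> B \<Longrightarrow> u e \<in> integer_lattice"
    "\<And>e. e \<in> B \<Longrightarrow> L \<le> l e" "\<And>e. e \<in> B \<Longrightarrow> e = l e *\<^sub>R u e"
    by metis
  have "(c - 1) *\<^sub>R (q - v) \<in> span B"
    using B(4)[OF qS v] by (rule span_mul)
  then obtain s where s: "(c - 1) *\<^sub>R (q - v) = (\<Sum>e\<in>B. s e *\<^sub>R e)"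
    using span_finite[OF B(1)] by auto
  \<comment> \<open>Coefficients with respect to the lattice vectors \<open>u e\<close>. Below,
    \<open>r e\<close> is the rounding error of \<open>\<beta> e\<close> measured in units of the
    long edge \<open>e\<close>, and \<open>w\<close> is the total error.\<close>
  define \<beta> where "\<beta> e = s e * l e" for e
  define z where "z = (\<Sum>e\<in>B. real_of_int (round (\<beta> e)) *\<^sub>R u e)"
  have z: "z \<in> integer_lattice"
    unfolding z_def using B(1) ul(1) by (intro integer_lattice_sum_scaleR) auto
  define r where "r e = (real_of_int (round (\<beta> e)) - \<beta> e) / l e" for e
  define w where "w = (\<Sum>e\<in>B. r e *\<^sub>R e)"
  have w: "z = (c - 1) *\<^sub>R (q - v) + w"
  proof -
    have "real_of_int (round (\<beta> e)) *\<^sub>R u e = s e *\<^sub>R e + r e *\<^sub>R e" if e: "e \<in> B" for e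
    proof -
      have "l e > 0" using ul(2)[OF e] L by simp
      have "s e *\<^sub>R e + r e *\<^sub>R e = (s e + r e) *\<^sub>R (l e *\<^sub>R u e)"
        using ul(3)[OF e] by (metis scaleR_add_left)
      also have "\<dots> = ((s e + r e) * l e) *\<^sub>R u e" by simp
      also have "(s e + r e) * l e = real_of_int (round (\<beta> e))"
        using \<open>l e > 0\<close> by (simp add: r_def \<beta>_def field_simps)
      finally show ?thesis by simp
    qed
    then show ?thesis
      unfolding z_def w_def s by (simp add: sum.distrib)
  qed
  \<comment> \<open>This estimate fixes the constant in the edge bound: at most
    \<open>\<phi> * D\<close> errors of size \<open>1 / (2 * L)\<close>, where \<open>2 * L\<close>
    equals \<open>D\<close> times \<open>D * k * (D + 1)\<close>, and \<open>1 / (D * k)\<close> is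
    at most \<open>t\<close>.\<close>
  have r: "(\<Sum>e\<in>B. \<bar>r e\<bar>) \<le> t * \<phi> / (D + 1)"
  proof -
    have "\<bar>r e\<bar> \<le> 1 / (2 * L)" if e: "e \<in> B" for e
    proof -
      have "\<bar>r e\<bar> = \<bar>real_of_int (round (\<beta> e)) - \<beta> e\<bar> / l e"
        using ul(2)[OF e] L by (simp add: r_def)
      also have "\<dots> \<le> (1 / 2) / L"
        using ul(2)[OF e] L of_int_round_abs_le[of "\<beta> e"] by (intro frac_le) auto
      finally show ?thesis by simp
    qed
    then have "(\<Sum>e\<in>B. \<bar>r e\<bar>) \<le> real (card B) * (1 / (2 * L))"
      by (rule sum_bounded_above)
    also have "\<dots> \<le> (\<phi> * D) * (1 / (2 * L))"
      using B(2) L D by (intro mult_right_mono) (auto simp: \<phi>_def)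
    also have "2 * L = D * (D * k * (D + 1))"
      by (simp add: L_def power2_eq_square)
    also have "\<phi> * D * (1 / (D * (D * k * (D + 1)))) = (1 / (D * k)) * \<phi> / (D + 1)"
      using D by simp
    also have "\<dots> \<le> t * \<phi> / (D + 1)"
      using t(1) \<phi> D by (intro divide_right_mono mult_right_mono) auto
    finally show ?thesis .
  qed
  \<comment> \<open>Only \<open>g\<close> is displaced, by \<open>(\<tau> / t) *\<^sub>R w\<close>;
    its weight \<open>t\<close> in \<open>q\<close> scales this back to
    \<open>\<tau> *\<^sub>R w\<close>.\<close>
  have room: "q + \<tau> *\<^sub>R w \<in> S" if \<tau>: "\<bar>\<tau>\<bar> \<le> 1 / \<phi>" for \<tau>
  proof -
    have "g + (\<Sum>e\<in>B. (\<tau> / t * r e) *\<^sub>R e) \<in> S"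
    proof (rule symmetric_center_room[where M = "D + 1"])
      show "\<exists>x\<in>S. \<exists>y\<in>S. e = y - x" if "e \<in> B" for e
        using B(3)[OF that] edge_of_imp_subset by (metis ends_in_segment subsetD)
      have "(\<Sum>e\<in>B. \<bar>\<tau> / t * r e\<bar>) = \<bar>\<tau>\<bar> / t * (\<Sum>e\<in>B. \<bar>r e\<bar>)"
        using tpos by (simp add: sum_distrib_left abs_mult)
      also have "\<dots> \<le> (1 / \<phi>) / t * (t * \<phi> / (D + 1))"
        using \<tau> tpos r \<phi> by (intro mult_mono divide_right_mono) (auto intro: sum_nonneg)
      also have "\<dots> = 1 / (D + 1)" using tpos \<phi> by simp
      finally show "(\<Sum>e\<in>B. \<bar>\<tau> / t * r e\<bar>) \<le> 1 / (D + 1)" .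
    qed (use cS g B(1) D in auto)
    then have "(1 - t) *\<^sub>R p + t *\<^sub>R (g + (\<Sum>e\<in>B. (\<tau> / t * r e) *\<^sub>R e)) \<in> S"
      using cS p t tpos by (intro convexD) auto
    also have "(\<Sum>e\<in>B. (\<tau> / t * r e) *\<^sub>R e) = (\<tau> / t) *\<^sub>R w"
      by (simp add: w_def scaleR_sum_right)
    finally show ?thesis using tpos by (simp add: q scaleR_add_right add.assoc)
  qed
  \<comment> \<open>The lattice shift makes \<open>(c - 1) *\<^sub>R y\<close> equal to
    \<open>(c - 1) *\<^sub>R q + w\<close>, leaving \<open>q - w\<close> as remainder;
    \<open>f\<close> is obtained by solving for it with weight \<open>\<phi>\<close>. Both multiples
    of \<open>w\<close> are within the room, as
    \<open>1 / (c - 1) \<le> 1 \<le> 1 / \<phi>\<close>.\<close>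
  define y where "y = q + (1 / (c - 1)) *\<^sub>R w"
  define f where "f = q + (- 1 / \<phi>) *\<^sub>R w"
  have cy: "(c - 1) *\<^sub>R y = (c - 1) *\<^sub>R q + w"
    using c by (simp add: y_def scaleR_add_right)
  have "1 / (c - 1) \<le> 1" using c by simp
  also have "1 \<le> 1 / \<phi>" using \<phi> by simp
  finally have "y \<in> S" unfolding y_def using c by (intro room) simp
  moreover have "f \<in> S" unfolding f_def using \<phi> by (intro room) simp
  moreover have "(c - 1) *\<^sub>R v + z = (c - 1) *\<^sub>R y"
    using w cy by (simp add: scaleR_diff_right)
  moreover have "c *\<^sub>R q - (c - 1) *\<^sub>R y = \<phi> *\<^sub>R f + (1 - \<phi>) *\<^sub>R q"
    using \<phi> unfolding cy f_def by (simp add: algebra_simps)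
  ultimately show ?thesis using z by blast
qed

text \<open>The weight kept on \<open>q\<close> drops by \<open>1 / D\<close> per dimension. Passing
  from a facet to \<open>S\<close> thus frees weight \<open>1 / D\<close> on \<open>p\<close>, which
  pays for moving from \<open>p\<close> to \<open>q\<close>.\<close>

lemma polytope_decomposition:
  fixes S :: "(real^'n) set" and c k :: real
  defines "D \<equiv> real CARD('n)"
  assumes "polytope S" "q \<in> S" "2 \<le> c" "c \<le> k"
    and "\<And>x y. closed_segment x y edge_of S \<Longrightarrow>
      \<exists>u\<in>integer_lattice. \<exists>l. 1 / 2 * D ^ 2 * (D + 1) * k \<le> l \<and> y - x = l *\<^sub>R u"
  shows "\<exists>v\<in>vert S. \<exists>z\<in>integer_lattice. \<exists>y\<in>S. \<exists>f\<in>S. (c - 1) *\<^sub>R v + z = (c - 1) *\<^sub>R y \<and>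
    c *\<^sub>R q - (c - 1) *\<^sub>R y
      = (real_of_int (aff_dim S) / D) *\<^sub>R f + (1 - real_of_int (aff_dim S) / D) *\<^sub>R q"
  using assms(2-)
proof (induction "nat (aff_dim S)" arbitrary: S q rule: less_induct)
  case less
  have D: "D \<ge> 1" unfolding D_def by (simp add: Suc_leI)
  have k: "k \<ge> 2" using less.prems by simp
  have cS: "convex S" using less.prems(1) by (rule polytope_imp_convex)
  have ne: "S \<noteq> {}" using less.prems(2) by blast
  then have "aff_dim S \<ge> 0" by (metis aff_dim_negative_iff not_le)
  then consider "aff_dim S = 0" | "aff_dim S \<ge> 1" by linarith
  then show ?case
  proof cases
    case 1
    then have S: "S = {q}" using less.prems(2) by (auto simp: aff_dim_eq_0)
    then have "q \<in> vert S" by (simp add: vert_def extreme_point_of_def)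
    moreover have "(0::real^'n) \<in> integer_lattice" by (simp add: integer_lattice_def)
    ultimately show ?thesis
      using 1 less.prems(2) by (intro bexI[of _ q] bexI[of _ 0]) (auto simp: algebra_simps)
  next
    case 2
    obtain g where g: "g \<in> rel_interior S"
      "\<And>a b. \<lbrakk>a \<in> S; b \<in> S\<rbrakk> \<Longrightarrow> g + (1 / (D + 1)) *\<^sub>R (a - b) \<in> S"
      using polytope_symmetric_center[OF less.prems(1) ne] unfolding D_def by auto
    have gS: "g \<in> S" using g(1) rel_interior_subset by blast
    obtain p where p: "p \<in> rel_frontier S" "q \<in> closed_segment g p"
    proof (rule segment_to_rel_frontier[OF cS _ g(1) less.prems(2)])
      show "bounded S" using less.prems(1) by (rule polytope_imp_bounded)
      show "\<not> (g = q \<and> S = {g})" using 2 by auto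
    qed (use that in blast)
    obtain F where F: "F facet_of S" "p \<in> F"
      using p(1) rel_frontier_of_polyhedron polytope_imp_polyhedron less.prems(1) by blast
    then have face: "F face_of S" and Fdim: "aff_dim F = aff_dim S - 1"
      by (auto simp: facet_of_def)
    have FS: "F \<subseteq> S" using face by (rule face_of_imp_subset)
    obtain t where t: "0 \<le> t" "t \<le> 1" "q = (1 - t) *\<^sub>R p + t *\<^sub>R g"
      using p(2) by (subst (asm) closed_segment_commute) (auto simp: in_segment)
    show ?thesis
    proof (cases "1 / (D * k) \<le> t")
      case True
      obtain v where v: "v extreme_point_of S"
        using extreme_point_exists_convex polytope_imp_compact[OF less.prems(1)] cS ne by blast
      then have "v \<in> S" "v \<in> vert S" by (auto simp: extreme_point_of_def vert_def)
      then show ?thesis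
        using near_center_decomposition[of S c k g p q t v] less.prems 2 gS g(2) t True F FS
        unfolding D_def by blast
    next
      case False
      define \<phi> where "\<phi> = real_of_int (aff_dim S) / D"
      have \<phi>: "\<phi> > 0" using 2 D by (simp add: \<phi>_def)
      have "aff_dim S \<le> int CARD('n)" using aff_dim_le_DIM[of S] by simp
      then have \<phi>1: "\<phi> \<le> 1" using D by (simp add: \<phi>_def D_def)
      have \<phi>F: "real_of_int (aff_dim F) / D = \<phi> - 1 / D"
        using Fdim by (simp add: \<phi>_def diff_divide_distrib)
      have \<phi>D: "\<phi> - 1 / D \<ge> 0" using 2 D by (simp add: \<phi>_def divide_right_mono)
      have "\<exists>v\<in>vert F. \<exists>z\<in>integer_lattice. \<exists>y\<in>F. \<exists>f\<in>F. (c - 1) *\<^sub>R v + z = (c - 1) *\<^sub>R y \<and>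
          c *\<^sub>R p - (c - 1) *\<^sub>R y
            = (real_of_int (aff_dim F) / D) *\<^sub>R f + (1 - real_of_int (aff_dim F) / D) *\<^sub>R p"
      proof (rule less.hyps)
        show "nat (aff_dim F) < nat (aff_dim S)" using Fdim 2 by simp
        show "polytope F" using less.prems(1) face by (rule face_of_polytope_polytope)
        show "\<exists>u\<in>integer_lattice. \<exists>l. 1 / 2 * D ^ 2 * (D + 1) * k \<le> l \<and> y - x = l *\<^sub>R u"
          if "closed_segment x y edge_of F" for x y
          using that face less.prems(5) by (meson edge_of_def face_of_trans)
      qed (use less.prems F in auto)
      then obtain v z y f where vz: "v \<in> vert F" "z \<in> integer_lattice" "y \<in> F" "f \<in> F"
        "(c - 1) *\<^sub>R v + z = (c - 1) *\<^sub>R y"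
        "c *\<^sub>R p - (c - 1) *\<^sub>R y = (\<phi> - 1 / D) *\<^sub>R f + (1 - (\<phi> - 1 / D)) *\<^sub>R p"
        unfolding \<phi>F by blast
      have "v \<in> vert S"
        using vz(1) extreme_point_of_face[OF face] by (simp add: vert_def)
      \<comment> \<open>Solving the desired equation for \<open>\<phi> *\<^sub>R h\<close> leaves
        weight \<open>\<alpha>\<close> on \<open>g\<close> and \<open>1 / D - \<alpha>\<close> on
        \<open>p\<close>. The latter is nonnegative because \<open>c - 1 + \<phi> \<le> k\<close>
        and \<open>t < 1 / (D * k)\<close>.\<close>
      define \<alpha> where "\<alpha> = t * (c - 1 + \<phi>)"
      have \<alpha>0: "\<alpha> \<ge> 0" using t less.prems \<phi> by (simp add: \<alpha>_def)
      have "\<alpha> \<le> t * k" unfolding \<alpha>_def using t less.prems \<phi>1 by (intro mult_left_mono) auto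
      also have "\<dots> \<le> 1 / (D * k) * k" using False k by (intro mult_right_mono) auto
      also have "\<dots> = 1 / D" using k by simp
      finally have \<alpha>1: "\<alpha> \<le> 1 / D" .
      define h where "h = ((\<phi> - 1 / D) / \<phi>) *\<^sub>R f + (\<alpha> / \<phi>) *\<^sub>R g
        + ((1 / D - \<alpha>) / \<phi>) *\<^sub>R p"
      have "h \<in> S"
      proof -
        have "(\<phi> - 1 / D) / \<phi> + \<alpha> / \<phi> + (1 / D - \<alpha>) / \<phi> = 1"
          using \<phi> by (simp add: add_divide_distrib[symmetric])
        moreover have "0 \<le> (\<phi> - 1 / D) / \<phi>" "0 \<le> \<alpha> / \<phi>" "0 \<le> (1 / D - \<alpha>) / \<phi>"
          using \<phi> \<phi>D \<alpha>0 \<alpha>1 by auto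
        ultimately have "h \<in> convex hull {f, g, p}"
          unfolding convex_hull_3 h_def by blast
        also have "convex hull {f, g, p} \<subseteq> S"
          using vz(4) FS gS F(2) cS by (intro hull_minimal) auto
        finally show ?thesis .
      qed
      moreover have "c *\<^sub>R q - (c - 1) *\<^sub>R y = \<phi> *\<^sub>R h + (1 - \<phi>) *\<^sub>R q"
      proof -
        have h: "\<phi> *\<^sub>R h = (\<phi> - 1 / D) *\<^sub>R f + \<alpha> *\<^sub>R g + (1 / D - \<alpha>) *\<^sub>R p"
          using \<phi> by (simp add: h_def scaleR_add_right)
        have "c *\<^sub>R q - (c - 1) *\<^sub>R y = c *\<^sub>R (q - p) + (c *\<^sub>R p - (c - 1) *\<^sub>R y)"
          by (simp add: algebra_simps)
        also have "\<dots> = \<phi> *\<^sub>R h + (1 - \<phi>) *\<^sub>R q"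
          unfolding vz(6) h t(3) \<alpha>_def by (simp add: algebra_simps)
        finally show ?thesis .
      qed
      ultimately show ?thesis
        using \<open>v \<in> vert S\<close> vz FS unfolding \<phi>_def[symmetric] by blast
    qed
  qed
qed

section \<open>From the decomposition to convex-normality\<close>

theorem theorem1p2:
  fixes P :: "(real^'n) set" and k :: real
  assumes "k \<in> \<rat>" and "k \<ge> 2"
    and "rational_polytope P" and "aff_dim P = int CARD('n)"
    and "\<And>x y. closed_segment x y edge_of P \<Longrightarrow>
           lattice_length x y \<ge> 1 / 2 * real CARD('n) ^ 2 * (real CARD('n) + 1) * k"
  shows "convex_normal k P"
proof -
  have P: "polytope P" and rat: "\<And>v i. v \<in> vert P \<Longrightarrow> v $ i \<in> \<rat>"
    using assms(3) by (auto simp: rational_polytope_def)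
  have cP: "convex P" using P by (rule polytope_imp_convex)
  have edges: "\<exists>u\<in>integer_lattice. \<exists>l.
      1 / 2 * real CARD('n) ^ 2 * (real CARD('n) + 1) * k \<le> l \<and> y - x = l *\<^sub>R u"
    if e: "closed_segment x y edge_of P" for x y
  proof -
    have face: "closed_segment x y face_of P" and "x \<noteq> y"
      using e by (auto simp: edge_of_def)
    have "x \<in> vert P" "y \<in> vert P"
      using extreme_point_of_face[OF face] by (auto simp: vert_def extreme_point_of_segment)
    then obtain u where "u \<in> integer_lattice" "y - x = lattice_length x y *\<^sub>R u"
      using lattice_length_eq[OF \<open>x \<noteq> y\<close>] rat by metis
    then show ?thesis using assms(5)[OF e] by blast
  qed
  show ?thesis
    unfolding convex_normal_def
  proof (intro ballI impI, elim conjE, intro subset_antisym subsetI)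
    fix c x assume c: "2 \<le> c" "c \<le> k" and "x \<in> (\<lambda>p. c *\<^sub>R p) ` P"
    then obtain q where q: "q \<in> P" "x = c *\<^sub>R q" by blast
    \<comment> \<open>In full dimension the weight of \<open>f\<close> is 1 and the term in
      \<open>q\<close> vanishes.\<close>
    obtain v z y f where vz: "v \<in> vert P" "z \<in> integer_lattice" "y \<in> P" "f \<in> P"
      "(c - 1) *\<^sub>R v + z = (c - 1) *\<^sub>R y" "c *\<^sub>R q - (c - 1) *\<^sub>R y = f"
      using polytope_decomposition[OF P q(1) c edges] assms(4) by auto
    have "x = (c - 1) *\<^sub>R y + f" using vz(6) q(2) by (simp add: algebra_simps)
    then show "x \<in> (\<Union>v\<in>vert P. \<Union>x\<in>(\<lambda>p. (c - 1) *\<^sub>R p) ` P \<inter>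
        (\<lambda>z. (c - 1) *\<^sub>R v + z) ` integer_lattice. (\<lambda>p. x + p) ` P)"
      using vz by (intro UN_I[of v] UN_I[of "(c - 1) *\<^sub>R y"] IntI) (auto intro: rev_image_eqI)
  next
    fix c x assume c: "2 \<le> c" "c \<le> k" and "x \<in> (\<Union>v\<in>vert P. \<Union>x\<in>(\<lambda>p. (c - 1) *\<^sub>R p) ` P \<inter>
        (\<lambda>z. (c - 1) *\<^sub>R v + z) ` integer_lattice. (\<lambda>p. x + p) ` P)"
    then obtain y f where yf: "y \<in> P" "f \<in> P" "x = (c - 1) *\<^sub>R y + f" by blast
    \<comment> \<open>The reverse inclusion is convexity: \<open>x\<close> divided by
      \<open>c\<close> is a convex combination of \<open>y\<close> and \<open>f\<close>.\<close>
    have "((c - 1) / c) *\<^sub>R y + (1 / c) *\<^sub>R f \<in> P"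
      using cP yf c by (intro convexD) (auto simp: add_divide_distrib[symmetric])
    moreover have "x = c *\<^sub>R (((c - 1) / c) *\<^sub>R y + (1 / c) *\<^sub>R f)"
      using c yf(3) by (simp add: scaleR_add_right)
    ultimately show "x \<in> (\<lambda>p. c *\<^sub>R p) ` P" by blast
  qed
qed

end
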